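(* Fix $p\in(0,1)$. For each $n$, let $(\xi_{ij})_{i,j\in[n]}$ be i.i.d. Bernoulli$(p)$ random variables (the biadjacency matrix of a bipartite Erdős–Rényi graph with $n+n$ vertices), and let $$H_n:=\frac{1}{p^n\,n!}\sum_{\sigma\in S_n}\prod_{i=1}^n\xi_{i\sigma(i)}$$ be the normalized number of perfect matchings. Then, as $n\to\infty$, $H_n$ converges weakly to $\exp(X)$ with $X\sim\mathcal N\big(-\tfrac{1-p}{2p},\tfrac{1-p}{p}\big)$, i.e. to the lognormal distribution with parameters $-\frac{1-p}{2p}$ and $\frac{1-p}{p}$.
   Context: $S_n$ is the symmetric group on $[n]=\{1,\dots,n\}$. $\mathcal N(a,s^2)$ is the normal law with mean $a$ and variance $s^2$. *)

theory Defs
  imports "HOL-Probability.Probability"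
begin

definition H_val :: "real \<Rightarrow> nat \<Rightarrow> (nat \<times> nat \<Rightarrow> bool) \<Rightarrow> real" where
  "H_val p n xi = (1 / (p ^ n * fact n)) *
     (\<Sum>\<sigma>\<in>{\<sigma>. \<sigma> permutes {1..n}}. \<Prod>i=1..n. (if xi (i, \<sigma> i) then 1 else 0))"

definition bern_matrix :: "real \<Rightarrow> nat \<Rightarrow> (nat \<times> nat \<Rightarrow> bool) pmf" where
  "bern_matrix p n = Pi_pmf ({1..n} \<times> {1..n}) False (\<lambda>_. bernoulli_pmf p)"

definition H_law :: "real \<Rightarrow> nat \<Rightarrow> real measure" where
  "H_law p n = measure_pmf (map_pmf (H_val p n) (bern_matrix p n))"

definition lognormal :: "real \<Rightarrow> real \<Rightarrow> real measure" where
  "lognormal mu s2 = distr (density lborel (normal_density mu (sqrt s2))) borel exp"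

end

theory Submission
  imports Defs "HOL-Real_Asymp.Real_Asymp"
begin

text \<open>
  Put \<open>v = (1 - p) / p\<close> and \<open>\<zeta>\<^sub>i\<^sub>j = \<xi>\<^sub>i\<^sub>j / p - 1\<close>, which has mean \<open>0\<close> and variance \<open>v\<close>. The
  permanent \<open>H\<close> is compared in \<open>L\<^sup>2\<close> with the product \<open>G = \<Prod>\<^sub>i\<^sub>j (1 + \<zeta>\<^sub>i\<^sub>j / n)\<close> over all \<open>n\<^sup>2\<close> entries.
  By independence \<open>E G\<^sup>2 = (1 + v / n\<^sup>2) ^ n\<^sup>2\<close> and \<open>E H G = (1 + v / n) ^ n\<close>;
  counting agreements of pairs of permutations gives \<open>E H\<^sup>2 = \<Sum>k\<le>n. v\<^sup>k / k!\<close>. All three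
  tend to \<open>exp v\<close>, so \<open>E (H - G)\<^sup>2\<close> tends to \<open>0\<close>. Finally \<open>ln G\<close> is a sum of \<open>n\<^sup>2\<close> i.i.d. terms, and
  its characteristic function converges to that of the normal law with mean \<open>- v / 2\<close> and
  variance \<open>v\<close>.
\<close>

section \<open>Products of independent variables and limits of characteristic functions\<close>

lemma expectation_prod_Pi_pmf_finite:
  fixes f :: "'a \<Rightarrow> 'b \<Rightarrow> 'c :: {real_normed_field, banach, second_countable_topology}"
  assumes fin: "finite A" and supp: "\<And>x. x \<in> A \<Longrightarrow> finite (set_pmf (q x))"
  shows "measure_pmf.expectation (Pi_pmf A d q) (\<lambda>y. \<Prod>x\<in>A. f x (y x)) =
         (\<Prod>x\<in>A. measure_pmf.expectation (q x) (f x))"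
proof -
  let ?P = "Pi_pmf A d q"
  have "finite (set_pmf ?P)"
    by (simp add: set_Pi_pmf[OF fin] finite_PiE_dflt fin supp)
  then have int: "integrable ?P g" for g :: "('a \<Rightarrow> 'b) \<Rightarrow> 'c"
    by (rule integrable_measure_pmf_finite)
  have "prob_space.indep_vars ?P (\<lambda>_. borel) (\<lambda>x y. f x (y x)) A"
    by (rule prob_space.indep_vars_compose2[OF measure_pmf.prob_space_axioms
          indep_vars_Pi_pmf[OF fin, of d q]]) simp
  then have "measure_pmf.expectation ?P (\<lambda>y. \<Prod>x\<in>A. f x (y x)) =
      (\<Prod>x\<in>A. measure_pmf.expectation ?P (\<lambda>y. f x (y x)))"
    by (intro prob_space.indep_vars_lebesgue_integral[OF measure_pmf.prob_space_axioms fin] int)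
  also have "\<dots> = (\<Prod>x\<in>A. measure_pmf.expectation (map_pmf (\<lambda>y. y x) ?P) (f x))"
    by simp
  also have "\<dots> = (\<Prod>x\<in>A. measure_pmf.expectation (q x) (f x))"
    by (intro prod.cong) (simp_all add: Pi_pmf_component[OF fin])
  finally show ?thesis .
qed

lemma filterlim_square_nat: "filterlim (\<lambda>n::nat. n ^ 2) at_top at_top"
  by (rule filterlim_at_top_mono[OF filterlim_ident]) (simp add: power2_eq_square)

lemma norm_iexp_diff_le: "norm (iexp x - iexp y) \<le> \<bar>x - y\<bar>"
proof -
  have "iexp x - iexp y = iexp y * (iexp (x - y) - 1)"
    by (simp add: right_diff_distrib flip: exp_add)
  then have "norm (iexp x - iexp y) = norm (iexp (x - y) - 1)"
    by (simp add: norm_mult)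
  also have "\<dots> \<le> \<bar>x - y\<bar>"
    using iexp_approx1[of "x - y" 0] by simp
  finally show ?thesis .
qed

text \<open>The hypotheses \<open>norm (\<phi> n) \<le> 1\<close> and \<open>Re z \<le> 0\<close> keep both \<open>\<phi> n\<close> and \<open>exp (z / N n)\<close> in
  the unit disc, where taking \<open>N\<close>-th powers is \<open>N\<close>-Lipschitz.\<close>

lemma power_tendsto_exp:
  fixes \<phi> :: "nat \<Rightarrow> complex"
  assumes norm: "\<And>n. norm (\<phi> n) \<le> 1" and z: "Re z \<le> 0"
    and lim: "(\<lambda>n. of_nat (N n) * (\<phi> n - 1)) \<longlonglongrightarrow> z" and N: "filterlim N at_top sequentially"
  shows "(\<lambda>n. \<phi> n ^ N n) \<longlonglongrightarrow> exp z"
proof -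
  have N_inf: "filterlim (\<lambda>n. of_nat (N n) :: complex) at_infinity sequentially"
    using filterlim_compose[OF tendsto_of_nat N] .
  have pos: "eventually (\<lambda>n. N n > 0) sequentially"
    using eventually_compose_filterlim[OF eventually_gt_at_top N] .
  have exp_lim: "(\<lambda>n. of_nat (N n) * (exp (z / of_nat (N n)) - 1)) \<longlonglongrightarrow> z"
  \<comment> \<open>The limit comes from the derivative of exp at 0, taken along
    \<open>z / of_nat (N n)\<close>; the punctured neighbourhood of 0 requires these increments to
    be nonzero.\<close>
  proof (cases "z = 0")
    case False
    have "((\<lambda>w :: complex. (exp w - 1) / w) \<longlongrightarrow> 1) (at 0)"
      using DERIV_exp[of "0::complex"] by (simp add: DERIV_def)
    moreover have "filterlim (\<lambda>n. z / of_nat (N n)) (at 0) sequentially"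
      unfolding filterlim_at using tendsto_divide_0[OF tendsto_const N_inf, of z] False pos
      by (auto elim: eventually_mono)
    ultimately have "(\<lambda>n. (exp (z / of_nat (N n)) - 1) / (z / of_nat (N n))) \<longlonglongrightarrow> 1"
      by (rule filterlim_compose)
    from tendsto_mult_left[OF this, of z] show ?thesis
      using False by (simp add: mult.commute)
  qed simp
  \<comment> \<open>The Lipschitz bound \<open>N n\<close> times the distance of the bases is the
    distance between N (\<phi> - 1) and N (exp (z / N) - 1). Both tend to \<open>z\<close>, so no
    complex logarithm of \<phi> has to be taken.\<close>
  have "(\<lambda>n. \<phi> n ^ N n - exp (z / of_nat (N n)) ^ N n) \<longlonglongrightarrow> 0"
  proof (rule Lim_null_comparison)
    show "(\<lambda>n. norm (of_nat (N n) * (\<phi> n - 1) - of_nat (N n) * (exp (z / of_nat (N n)) - 1))) \<longlonglongrightarrow> 0"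
      using tendsto_norm[OF tendsto_diff[OF lim exp_lim]] by simp
    show "eventually (\<lambda>n. norm (\<phi> n ^ N n - exp (z / of_nat (N n)) ^ N n) \<le>
      norm (of_nat (N n) * (\<phi> n - 1) - of_nat (N n) * (exp (z / of_nat (N n)) - 1))) sequentially"
    proof (intro always_eventually allI)
      fix n
      have "norm (exp (z / of_nat (N n))) \<le> 1"
        using z by (simp add: divide_nonpos_nonneg)
      from norm_power_diff[OF norm[of n] this, of "N n"]
      have "norm (\<phi> n ^ N n - exp (z / of_nat (N n)) ^ N n) \<le>
          norm (of_nat (N n) * (\<phi> n - exp (z / of_nat (N n))))"
        by (simp add: norm_mult)
      then show "norm (\<phi> n ^ N n - exp (z / of_nat (N n)) ^ N n) \<le>
          norm (of_nat (N n) * (\<phi> n - 1) - of_nat (N n) * (exp (z / of_nat (N n)) - 1))"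
        by (simp add: right_diff_distrib)
    qed
  qed
  moreover have "eventually (\<lambda>n. \<phi> n ^ N n - exp (z / of_nat (N n)) ^ N n = \<phi> n ^ N n - exp z) sequentially"
    using pos by eventually_elim (simp flip: exp_of_nat_mult)
  ultimately have "(\<lambda>n. \<phi> n ^ N n - exp z) \<longlonglongrightarrow> 0"
    by (rule Lim_transform_eventually)
  then show ?thesis
    by (simp add: LIM_zero_iff)
qed

lemma real_distribution_normal:
  "\<sigma> > 0 \<Longrightarrow> real_distribution (density lborel (normal_density \<mu> \<sigma>))"
  using prob_space_normal_density by (auto simp: real_distribution_def real_distribution_axioms_def)

text \<open>The law is the image of the standard normal law under x \<mapsto> \<mu> + \<sigma> x, so
  the known characteristic function of the latter is rescaled and multiplied by a phase.\<close>

lemma char_normal: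
  assumes "\<sigma> > 0"
  shows "char (density lborel (normal_density \<mu> \<sigma>)) t = iexp (t * \<mu>) * complex_of_real (exp (- (\<sigma> * t)\<^sup>2 / 2))"
proof -
  interpret real_distribution std_normal_distribution
    by (rule real_dist_normal_dist)
  have "distributed std_normal_distribution lborel (\<lambda>x. x) std_normal_density"
    by (auto simp: distributed_def distr_id2)
  from normal_density_affine[OF this, of \<sigma> \<mu>] assms
  have "distr std_normal_distribution lborel (\<lambda>x. \<mu> + \<sigma> * x) = density lborel (normal_density \<mu> \<sigma>)"
    by (simp add: distributed_def)
  then have "char (density lborel (normal_density \<mu> \<sigma>)) t =
      char (distr std_normal_distribution lborel (\<lambda>x. \<mu> + \<sigma> * x)) t"
    by simp
  also have "\<dots> = (CLINT x|std_normal_distribution. iexp (t * \<mu>) * iexp ((\<sigma> * t) * x))"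
    by (simp add: char_def integral_distr ring_distribs exp_add mult_ac)
  also have "\<dots> = iexp (t * \<mu>) * char std_normal_distribution (\<sigma> * t)"
    by (simp only: integral_mult_right_zero char_def)
  finally show ?thesis
    by (simp add: char_std_normal_distribution)
qed

section \<open>Products along graphs and sums over permutations\<close>

lemma prod_graph:
  fixes f :: "'a \<times> 'b \<Rightarrow> 'c :: comm_monoid_mult"
  assumes "finite B" "\<And>i. i \<in> A \<Longrightarrow> g i \<in> B"
  shows "(\<Prod>e\<in>A \<times> B. if g (fst e) = snd e then f e else 1) = (\<Prod>i\<in>A. f (i, g i))"
proof -
  have "(\<Prod>e\<in>A \<times> B. if g (fst e) = snd e then f e else 1) =
      (\<Prod>i\<in>A. \<Prod>j\<in>B. if g i = j then f (i, j) else 1)"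
    by (auto simp: prod.cartesian_product intro!: prod.cong)
  also have "\<dots> = (\<Prod>i\<in>A. f (i, g i))"
    using assms by (intro prod.cong) (auto simp: prod.delta)
  finally show ?thesis .
qed

text \<open>Substituting \<rho> = \<sigma>^(-1) \<tau> turns agreements of \<sigma> and \<tau> into
  fixed points of \<rho>, so the inner sum is the same for every \<sigma>.\<close>

lemma sum_permutations_two_agree:
  fixes c :: "'a :: {comm_semiring_1, semiring_char_0}"
  assumes "finite S"
  shows "(\<Sum>\<sigma>\<in>{\<sigma>. \<sigma> permutes S}. \<Sum>\<tau>\<in>{\<tau>. \<tau> permutes S}. \<Prod>i\<in>S. if \<sigma> i = \<tau> i then c else 1) =
    fact (card S) * (\<Sum>\<rho>\<in>{\<rho>. \<rho> permutes S}. \<Prod>i\<in>S. if \<rho> i = i then c else 1)"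
proof -
  have "(\<Sum>\<tau>\<in>{\<tau>. \<tau> permutes S}. \<Prod>i\<in>S. if \<sigma> i = \<tau> i then c else 1) =
      (\<Sum>\<rho>\<in>{\<rho>. \<rho> permutes S}. \<Prod>i\<in>S. if \<rho> i = i then c else 1)" if \<sigma>: "\<sigma> permutes S" for \<sigma>
  proof (rule sum.reindex_bij_witness[where i = "\<lambda>\<rho>. \<sigma> \<circ> \<rho>" and j = "\<lambda>\<tau>. inv \<sigma> \<circ> \<tau>"])
    fix \<tau> assume \<tau>: "\<tau> \<in> {\<tau>. \<tau> permutes S}"
    show "\<sigma> \<circ> (inv \<sigma> \<circ> \<tau>) = \<tau>"
      using permutes_inv_o[OF \<sigma>] by (simp add: o_assoc)
    show "inv \<sigma> \<circ> \<tau> \<in> {\<rho>. \<rho> permutes S}"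
      using \<tau> \<sigma> by (simp add: permutes_compose permutes_inv)
    show "(\<Prod>i\<in>S. if (inv \<sigma> \<circ> \<tau>) i = i then c else 1) = (\<Prod>i\<in>S. if \<sigma> i = \<tau> i then c else 1)"
      using permutes_inv_eq[OF \<sigma>] by simp
  next
    fix \<rho> assume \<rho>: "\<rho> \<in> {\<rho>. \<rho> permutes S}"
    show "inv \<sigma> \<circ> (\<sigma> \<circ> \<rho>) = \<rho>"
      using permutes_inv_o[OF \<sigma>] by (simp add: o_assoc)
    show "\<sigma> \<circ> \<rho> \<in> {\<tau>. \<tau> permutes S}"
      using \<rho> \<sigma> by (simp add: permutes_compose)
  qed
  then show ?thesis
    by (simp add: card_permutations[OF refl assms])
qed

text \<open>Write each factor as 1 plus \<open>v\<close> times the indicator of a fixed point and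
  multiply out: this gives a sum over sets A of points that are all fixed. With n =
  \<open>card S\<close>, exactly (n - k)! permutations fix a given k-set pointwise, and (n choose k)
  (n - k)! = n! / k!.\<close>

lemma sum_permutations_fixed_points:
  fixes v :: real
  assumes "finite S"
  shows "(\<Sum>\<rho>\<in>{\<rho>. \<rho> permutes S}. \<Prod>i\<in>S. if \<rho> i = i then 1 + v else 1) =
    fact (card S) * (\<Sum>k\<le>card S. v ^ k / fact k)"
proof -
  let ?P = "{\<rho>. \<rho> permutes S}"
  have fix_card: "card {\<rho> \<in> ?P. \<forall>i\<in>A. \<rho> i = i} = fact (card S - card A)" if "A \<subseteq> S" for A
  proof -
    have "{\<rho> \<in> ?P. \<forall>i\<in>A. \<rho> i = i} = {\<rho>. \<rho> permutes (S - A)}"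
      using that by (auto simp: permutes_def)
    then show ?thesis
      using that assms by (simp add: card_permutations[OF refl] card_Diff_subset finite_subset)
  qed
  have "(\<Sum>\<rho>\<in>?P. \<Prod>i\<in>S. if \<rho> i = i then 1 + v else 1) =
      (\<Sum>\<rho>\<in>?P. \<Prod>i\<in>S. (if \<rho> i = i then v else 0) + 1)"
    by (intro sum.cong prod.cong) auto
  also have "\<dots> = (\<Sum>\<rho>\<in>?P. \<Sum>A\<in>Pow S. \<Prod>i\<in>A. if \<rho> i = i then v else 0)"
    by (simp add: prod_add[OF assms])
  also have "\<dots> = (\<Sum>A\<in>Pow S. \<Sum>\<rho>\<in>?P. \<Prod>i\<in>A. if \<rho> i = i then v else 0)"
    by (rule sum.swap)
  also have "\<dots> = (\<Sum>A\<in>Pow S. v ^ card A * fact (card S - card A))"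
  proof (intro sum.cong refl)
    fix A assume A: "A \<in> Pow S"
    then have "finite A" using assms finite_subset by auto
    then have "(\<Sum>\<rho>\<in>?P. \<Prod>i\<in>A. if \<rho> i = i then v else 0) =
        (\<Sum>\<rho>\<in>?P. if \<forall>i\<in>A. \<rho> i = i then v ^ card A else 0)"
      by (intro sum.cong) (auto intro!: prod_zero)
    also have "\<dots> = (\<Sum>\<rho>\<in>{\<rho> \<in> ?P. \<forall>i\<in>A. \<rho> i = i}. v ^ card A)"
      by (intro sum.inter_filter[symmetric] finite_permutations assms)
    finally show "(\<Sum>\<rho>\<in>?P. \<Prod>i\<in>A. if \<rho> i = i then v else 0) = v ^ card A * fact (card S - card A)"
      using fix_card[of A] A by simp
  qed
  also have "\<dots> = (\<Sum>k\<le>card S. \<Sum>A\<in>{A \<in> Pow S. card A = k}. v ^ card A * fact (card S - card A))"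
    by (rule sum.group[symmetric]) (auto simp: assms card_mono)
  also have "\<dots> = (\<Sum>k\<le>card S. real (card S choose k) * (v ^ k * fact (card S - k)))"
  proof (intro sum.cong refl)
    fix k
    have "(\<Sum>A\<in>{A \<in> Pow S. card A = k}. v ^ card A * fact (card S - card A)) =
      (\<Sum>A\<in>{A. A \<subseteq> S \<and> card A = k}. v ^ k * fact (card S - k))"
      by (intro sum.cong) auto
    then show "(\<Sum>A\<in>{A \<in> Pow S. card A = k}. v ^ card A * fact (card S - card A)) =
      real (card S choose k) * (v ^ k * fact (card S - k))"
      by (simp add: n_subsets[OF assms])
  qed
  also have "\<dots> = (\<Sum>k\<le>card S. fact (card S) * (v ^ k / fact k))"
    by (intro sum.cong refl) (simp add: binomial_fact field_simps)
  finally show ?thesis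
    by (simp add: sum_distrib_left)
qed

section \<open>The random matrix, the permanent H and the product G\<close>

lemma integrable_bern_matrix:
  fixes f :: "_ \<Rightarrow> 'c :: {banach, second_countable_topology}"
  shows "integrable (bern_matrix p n) f"
  unfolding bern_matrix_def
  by (intro integrable_measure_pmf_finite) (simp add: set_Pi_pmf finite_PiE_dflt)

text \<open>The value type is a general normed field because the lemma serves both the real second
  moments and the complex characteristic function of \<open>log_edge_prod\<close>.\<close>

lemma expectation_prod_bern_matrix:
  fixes f :: "nat \<times> nat \<Rightarrow> bool \<Rightarrow> 'c :: {real_normed_field, banach, second_countable_topology}"
  assumes "0 \<le> p" "p \<le> 1"
  shows "measure_pmf.expectation (bern_matrix p n) (\<lambda>xi. \<Prod>e\<in>{1..n} \<times> {1..n}. f e (xi e)) =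
    (\<Prod>e\<in>{1..n} \<times> {1..n}. p *\<^sub>R f e True + (1 - p) *\<^sub>R f e False)"
  unfolding bern_matrix_def using assms
  by (subst expectation_prod_Pi_pmf_finite)
     (auto simp: integral_measure_pmf[of UNIV] UNIV_bool intro!: prod.cong)

definition edge_prod :: "real \<Rightarrow> nat \<Rightarrow> (nat \<times> nat \<Rightarrow> bool) \<Rightarrow> real" where
  "edge_prod p n xi = (\<Prod>e\<in>{1..n} \<times> {1..n}. 1 + ((if xi e then 1 / p else 0) - 1) / n)"

text \<open>A sum of logarithms splits over the independent entries. At \<open>n = 1\<close> a false
  entry gives \<open>ln 0\<close>, a default value, so the link to \<open>edge_prod\<close> in
  \<open>exp_log_edge_prod\<close> is stated from \<open>n \<ge> 2\<close> on.\<close>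

definition log_edge_prod :: "real \<Rightarrow> nat \<Rightarrow> (nat \<times> nat \<Rightarrow> bool) \<Rightarrow> real" where
  "log_edge_prod p n xi = (\<Sum>e\<in>{1..n} \<times> {1..n}. ln (1 + ((if xi e then 1 / p else 0) - 1) / n))"

text \<open>Distributing \<open>p ^ n\<close> over the factors puts a mean-one variable on each
  entry of the graph of \<sigma> and 1 elsewhere. As products over all entries, the terms can be
  multiplied by each other or by \<open>edge_prod\<close> and integrated entry by entry.\<close>

lemma H_val_eq:
  assumes "p \<noteq> 0"
  shows "H_val p n xi = (1 / fact n) * (\<Sum>\<sigma>\<in>{\<sigma>. \<sigma> permutes {1..n}}.
     \<Prod>e\<in>{1..n} \<times> {1..n}. if \<sigma> (fst e) = snd e then (if xi e then 1 / p else 0) else 1)"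
proof -
  have "(\<Prod>e\<in>{1..n} \<times> {1..n}. if \<sigma> (fst e) = snd e then (if xi e then 1 / p else 0) else 1) =
    (\<Prod>i=1..n. (if xi (i, \<sigma> i) then 1 else 0)) / p ^ n" if "\<sigma> permutes {1..n}" for \<sigma>
  proof -
    have "(\<Prod>e\<in>{1..n} \<times> {1..n}. if \<sigma> (fst e) = snd e then (if xi e then 1 / p else 0) else 1) =
      (\<Prod>i=1..n. if xi (i, \<sigma> i) then 1 / p else 0)"
      using permutes_in_image[OF that] by (intro prod_graph) auto
    also have "\<dots> = (\<Prod>i=1..n. (if xi (i, \<sigma> i) then 1 else 0) / p)"
      by (intro prod.cong) auto
    finally show ?thesis by (simp add: prod_dividef)
  qed
  then have "(1 / fact n) * (\<Sum>\<sigma>\<in>{\<sigma>. \<sigma> permutes {1..n}}.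
     \<Prod>e\<in>{1..n} \<times> {1..n}. if \<sigma> (fst e) = snd e then (if xi e then 1 / p else 0) else 1) =
     (1 / fact n) * (\<Sum>\<sigma>\<in>{\<sigma>. \<sigma> permutes {1..n}}. (\<Prod>i=1..n. (if xi (i, \<sigma> i) then 1 else 0)) / p ^ n)"
    by simp
  then show ?thesis
    by (simp add: H_val_def sum_divide_distrib[symmetric] field_simps)
qed

section \<open>Second moments and the distance between H and G in the mean square\<close>

context
  fixes p v :: real
  assumes p: "0 < p" "p < 1" and v: "v = (1 - p) / p"
begin

lemma expectation_edge_prod_sq:
  assumes "n > 0"
  shows "measure_pmf.expectation (bern_matrix p n) (\<lambda>xi. edge_prod p n xi ^ 2) = (1 + v / n ^ 2) ^ (n ^ 2)"
proof -
  have "measure_pmf.expectation (bern_matrix p n) (\<lambda>xi. edge_prod p n xi ^ 2) =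
    measure_pmf.expectation (bern_matrix p n) (\<lambda>xi. \<Prod>e\<in>{1..n} \<times> {1..n}.
      (1 + ((if xi e then 1 / p else 0) - 1) / n) ^ 2)"
    by (simp add: edge_prod_def prod_power_distrib)
  also have "\<dots> = (\<Prod>e\<in>{1..n} \<times> {1..n}.
      p *\<^sub>R (1 + ((if True then 1 / p else 0) - 1) / n) ^ 2 +
      (1 - p) *\<^sub>R (1 + ((if False then 1 / p else 0) - 1) / n) ^ 2)"
    using p by (intro expectation_prod_bern_matrix) auto
  \<comment> \<open>The cross term vanishes because \<zeta> has mean 0; its variance
    \<open>v\<close> leaves \<open>v / n ^ 2\<close>.\<close>
  also have "\<dots> = (\<Prod>e\<in>{1..n} \<times> {1..n}. 1 + v / n ^ 2)"
    by (intro prod.cong refl) (use p assms in \<open>simp add: v field_simps power2_eq_square\<close>)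
  also have "\<dots> = (1 + v / n ^ 2) ^ (n ^ 2)"
    by (simp add: power2_eq_square)
  finally show ?thesis .
qed

lemma expectation_H_edge_prod:
  assumes "n > 0"
  shows "measure_pmf.expectation (bern_matrix p n) (\<lambda>xi. H_val p n xi * edge_prod p n xi) = (1 + v / n) ^ n"
proof -
  let ?E = "{1..n} \<times> {1..n}"
  let ?f = "\<lambda>\<sigma> e b. (if \<sigma> (fst e) = snd e then (if b then 1 / p else 0) else 1) *
     (1 + ((if b then 1 / p else 0) - 1) / real n)"
  have 1: "measure_pmf.expectation (bern_matrix p n) (\<lambda>xi. \<Prod>e\<in>?E. ?f \<sigma> e (xi e)) = (1 + v / n) ^ n"
    if "\<sigma> permutes {1..n}" for \<sigma>
  proof -
    \<comment> \<open>An entry on the graph of \<sigma> contributes E (1 + \<zeta>) (1 + \<zeta> /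
      n) = 1 + v / n, any other entry E (1 + \<zeta> / n) = 1.\<close>
    have "measure_pmf.expectation (bern_matrix p n) (\<lambda>xi. \<Prod>e\<in>?E. ?f \<sigma> e (xi e)) =
      (\<Prod>e\<in>?E. if \<sigma> (fst e) = snd e then 1 + v / n else 1)"
      using p assms
      by (subst expectation_prod_bern_matrix) (auto intro!: prod.cong simp: v field_simps)
    also have "\<dots> = (\<Prod>i=1..n. 1 + v / n)"
      using permutes_in_image[OF that] by (intro prod_graph) auto
    finally show ?thesis by simp
  qed
  have "measure_pmf.expectation (bern_matrix p n) (\<lambda>xi. H_val p n xi * edge_prod p n xi) =
    measure_pmf.expectation (bern_matrix p n)
      (\<lambda>xi. (1 / fact n) * (\<Sum>\<sigma>\<in>{\<sigma>. \<sigma> permutes {1..n}}. \<Prod>e\<in>?E. ?f \<sigma> e (xi e)))"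
    using p by (simp add: H_val_eq edge_prod_def prod.distrib sum_distrib_right)
  also have "\<dots> = (1 / fact n) * (\<Sum>\<sigma>\<in>{\<sigma>. \<sigma> permutes {1..n}}.
      measure_pmf.expectation (bern_matrix p n) (\<lambda>xi. \<Prod>e\<in>?E. ?f \<sigma> e (xi e)))"
    by (subst integral_mult_right_zero, subst Bochner_Integration.integral_sum)
       (rule integrable_bern_matrix refl)+
  also have "\<dots> = (1 / fact n) * (\<Sum>\<sigma>\<in>{\<sigma>. \<sigma> permutes {1..n}}. (1 + v / n) ^ n)"
    using 1 by simp
  also have "\<dots> = (1 + v / n) ^ n"
    by (simp add: card_permutations[OF refl])
  finally show ?thesis .
qed

lemma expectation_H_sq:
  "measure_pmf.expectation (bern_matrix p n) (\<lambda>xi. H_val p n xi ^ 2) = (\<Sum>k\<le>n. v ^ k / fact k)"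
proof -
  let ?E = "{1..n} \<times> {1..n}"
  let ?P = "{\<sigma>. \<sigma> permutes {1..n}}"
  let ?f = "\<lambda>\<sigma> e b. (if \<sigma> (fst e) = snd e then (if b then 1 / p else 0) else 1) :: real"
  have 1: "measure_pmf.expectation (bern_matrix p n) (\<lambda>xi. \<Prod>e\<in>?E. ?f \<sigma> e (xi e) * ?f \<tau> e (xi e)) =
      (\<Prod>i=1..n. if \<sigma> i = \<tau> i then 1 + v else 1)"
    if "\<sigma> permutes {1..n}" for \<sigma> \<tau>
  proof -
    \<comment> \<open>Only an entry on both graphs has a mean other than 1, namely E (1 + \<zeta>)^2
      = 1 + v. The condition is nested, \<sigma> outside and \<tau> inside, so that
      \<open>prod_graph\<close> collapses the product along \<sigma>.\<close>
    have "measure_pmf.expectation (bern_matrix p n) (\<lambda>xi. \<Prod>e\<in>?E. ?f \<sigma> e (xi e) * ?f \<tau> e (xi e)) =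
      (\<Prod>e\<in>?E. if \<sigma> (fst e) = snd e then (if snd e = \<tau> (fst e) then 1 + v else 1) else 1)"
      using p
      by (subst expectation_prod_bern_matrix) (auto intro!: prod.cong simp: v field_simps)
    also have "\<dots> = (\<Prod>i=1..n. if snd (i, \<sigma> i) = \<tau> (fst (i, \<sigma> i)) then 1 + v else 1)"
      using permutes_in_image[OF that] by (intro prod_graph) auto
    finally show ?thesis by simp
  qed
  have "measure_pmf.expectation (bern_matrix p n) (\<lambda>xi. H_val p n xi ^ 2) =
    measure_pmf.expectation (bern_matrix p n)
      (\<lambda>xi. (1 / fact n ^ 2) * (\<Sum>\<sigma>\<in>?P. \<Sum>\<tau>\<in>?P. \<Prod>e\<in>?E. ?f \<sigma> e (xi e) * ?f \<tau> e (xi e)))"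
    using p by (simp only: H_val_eq prod.distrib sum_product power2_eq_square)
      (simp add: H_val_eq sum_product power2_eq_square)
  also have "\<dots> = (1 / fact n ^ 2) * (\<Sum>\<sigma>\<in>?P. \<Sum>\<tau>\<in>?P.
      measure_pmf.expectation (bern_matrix p n) (\<lambda>xi. \<Prod>e\<in>?E. ?f \<sigma> e (xi e) * ?f \<tau> e (xi e)))"
    by (subst integral_mult_right_zero, (subst Bochner_Integration.integral_sum, rule integrable_bern_matrix)+)
       (rule refl)
  also have "\<dots> = (1 / fact n ^ 2) * (\<Sum>\<sigma>\<in>?P. \<Sum>\<tau>\<in>?P. \<Prod>i=1..n. if \<sigma> i = \<tau> i then 1 + v else 1)"
    using 1 by simp
  also have "\<dots> = (\<Sum>k\<le>n. v ^ k / fact k)"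
    by (simp add: sum_permutations_two_agree sum_permutations_fixed_points power2_eq_square)
  finally show ?thesis .
qed

lemma expectation_H_minus_edge_prod_sq_tendsto:
  "(\<lambda>n. measure_pmf.expectation (bern_matrix p n) (\<lambda>xi. (H_val p n xi - edge_prod p n xi) ^ 2)) \<longlonglongrightarrow> 0"
proof -
  have eq: "measure_pmf.expectation (bern_matrix p n) (\<lambda>xi. (H_val p n xi - edge_prod p n xi) ^ 2) =
    (\<Sum>k\<le>n. v ^ k / fact k) + (1 + v / n ^ 2) ^ (n ^ 2) - 2 * (1 + v / n) ^ n" if "n > 0" for n
    using that
    by (simp add: power2_diff integrable_bern_matrix expectation_H_sq expectation_edge_prod_sq
        expectation_H_edge_prod mult.assoc)
  have "(\<lambda>n. \<Sum>k\<le>n. v ^ k / fact k) \<longlonglongrightarrow> exp v"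
    using exp_converges[of v] by (simp add: sums_def_le divide_inverse mult.commute)
  moreover have "(\<lambda>n. (1 + v / n) ^ n) \<longlonglongrightarrow> exp v"
    by (rule tendsto_exp_limit_sequentially)
  \<comment> \<open>This is the preceding limit along the subsequence of squares.\<close>
  moreover from filterlim_compose[OF this filterlim_square_nat]
  have "(\<lambda>n. (1 + v / n ^ 2) ^ (n ^ 2)) \<longlonglongrightarrow> exp v" .
  ultimately have "(\<lambda>n. (\<Sum>k\<le>n. v ^ k / fact k) + (1 + v / n ^ 2) ^ (n ^ 2) - 2 * (1 + v / n) ^ n)
      \<longlonglongrightarrow> exp v + exp v - 2 * exp v"
    by (intro tendsto_intros)
  then have "(\<lambda>n. (\<Sum>k\<le>n. v ^ k / fact k) + (1 + v / n ^ 2) ^ (n ^ 2) - 2 * (1 + v / n) ^ n) \<longlonglongrightarrow> 0"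
    by simp
  then show ?thesis
    by (rule Lim_transform_eventually[OF _ eventually_mono[OF eventually_gt_at_top[of 0]]])
       (simp_all add: eq)
qed

section \<open>The normal limit of ln G\<close>

lemma weak_conv_log_edge_prod:
  "weak_conv_m (\<lambda>n. distr (bern_matrix p n) borel (log_edge_prod p n))
     (density lborel (normal_density (- v / 2) (sqrt v)))"
proof (rule levy_continuity)
  fix t :: real
  let ?l = "\<lambda>n b. ln (1 + ((if b then 1 / p else 0) - 1) / real n)"
  define \<phi> where "\<phi> n = p *\<^sub>R iexp (t * ?l n True) + (1 - p) *\<^sub>R iexp (t * ?l n False)" for n
  \<comment> \<open>The exponent of the limiting normal characteristic function. Since \<zeta> has
    mean 0, ln (1 + \<zeta> / n) has mean about - v / (2 n^2) and second moment about v / n^2, so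
    n^2 (\<phi> n - 1) should tend to \<open>z\<close>.\<close>
  define z where "z = \<i> * complex_of_real (- t * v / 2) - complex_of_real (v * t\<^sup>2 / 2)"
  have char: "char (distr (bern_matrix p n) borel (log_edge_prod p n)) t = \<phi> n ^ (n ^ 2)" for n
  proof -
    have "char (distr (bern_matrix p n) borel (log_edge_prod p n)) t =
      measure_pmf.expectation (bern_matrix p n) (\<lambda>xi. \<Prod>e\<in>{1..n} \<times> {1..n}. iexp (t * ?l n (xi e)))"
      by (simp add: char_def integral_distr log_edge_prod_def sum_distrib_left flip: exp_sum)
    also have "\<dots> = (\<Prod>e\<in>{1..n} \<times> {1..n}. \<phi> n)"
      using p unfolding \<phi>_def by (intro expectation_prod_bern_matrix) auto
    finally show ?thesis by (simp add: power2_eq_square)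
  qed
  have norm: "norm (\<phi> n) \<le> 1" for n
  proof -
    have "norm (\<phi> n) \<le> p + (1 - p)"
      unfolding \<phi>_def using p by (intro norm_triangle_le add_mono) auto
    then show ?thesis by simp
  qed
  have Re: "(\<lambda>n. Re (of_nat (n ^ 2) * (\<phi> n - 1))) \<longlonglongrightarrow> Re z"
  proof -
    \<comment> \<open>The numbers 1 / p - 1 and -1 are the two values of \<zeta>, and cos x is 1 -
      x^2 / 2 to second order.\<close>
    have "(\<lambda>n. real n ^ 2 * (p * cos (t * ln (1 + (1 / p - 1) / real n)) +
        (1 - p) * cos (t * ln (1 + - 1 / real n)) - 1)) \<longlonglongrightarrow> - (p * (t * (1 / p - 1) * (t * (1 / p - 1))) / 2) - (1 - p) * (t * t) / 2"
      by real_asymp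
    also have "- (p * (t * (1 / p - 1) * (t * (1 / p - 1))) / 2) - (1 - p) * (t * t) / 2 = Re z"
      using p by (simp add: z_def v field_simps power2_eq_square)
    finally show ?thesis
      by (simp add: \<phi>_def Re_exp)
  qed
  have Im: "(\<lambda>n. Im (of_nat (n ^ 2) * (\<phi> n - 1))) \<longlonglongrightarrow> Im z"
  proof -
    \<comment> \<open>The term t c / n is removed first, since multiplied by n^2 it is of order n.
      What survives is the quadratic term of ln; the cubic term of sin is of order n^(-3).\<close>
    have sin_lim: "(\<lambda>n. real n ^ 2 * (sin (t * ln (1 + c / real n)) - t * c / real n))
        \<longlonglongrightarrow> - (t * (c * c)) / 2" for c
      by real_asymp
    have "(\<lambda>n. p * (real n ^ 2 * (sin (t * ln (1 + (1 / p - 1) / real n)) - t * (1 / p - 1) / real n)) +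
        (1 - p) * (real n ^ 2 * (sin (t * ln (1 + - 1 / real n)) - t * (- 1) / real n)))
        \<longlonglongrightarrow> p * (- (t * ((1 / p - 1) * (1 / p - 1))) / 2) + (1 - p) * (- (t * ((- 1) * (- 1))) / 2)"
      by (intro tendsto_intros sin_lim)
    also have "p * (- (t * ((1 / p - 1) * (1 / p - 1))) / 2) + (1 - p) * (- (t * ((- 1) * (- 1))) / 2) =
        - t * v / 2"
      using p by (simp add: v field_simps)
    also have "(\<lambda>n. p * (real n ^ 2 * (sin (t * ln (1 + (1 / p - 1) / real n)) - t * (1 / p - 1) / real n)) +
        (1 - p) * (real n ^ 2 * (sin (t * ln (1 + - 1 / real n)) - t * (- 1) / real n))) =
        (\<lambda>n. real n ^ 2 * (p * sin (t * ln (1 + (1 / p - 1) / real n)) +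
        (1 - p) * sin (t * ln (1 + - 1 / real n))))"
    proof
      fix n :: nat
      have lin: "p * (N * (a - x)) + (1 - p) * (N * (b - y)) =
          N * (p * a + (1 - p) * b) - N * (p * x + (1 - p) * y)" for N a b x y
        by (simp add: algebra_simps)
      \<comment> \<open>The removed linear terms cancel on average because \<zeta> has mean
        0.\<close>
      have "p * (t * (1 / p - 1) / real n) + (1 - p) * (t * (- 1) / real n) = 0"
        using p by (cases "n = 0") (simp_all add: field_simps)
      then show "p * (real n ^ 2 * (sin (t * ln (1 + (1 / p - 1) / real n)) - t * (1 / p - 1) / real n)) +
        (1 - p) * (real n ^ 2 * (sin (t * ln (1 + - 1 / real n)) - t * (- 1) / real n)) =
        real n ^ 2 * (p * sin (t * ln (1 + (1 / p - 1) / real n)) +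
        (1 - p) * sin (t * ln (1 + - 1 / real n)))"
        by (simp only: lin)
    qed
    finally show ?thesis
      by (simp add: \<phi>_def z_def Im_exp)
  qed
  have "(\<lambda>n. \<phi> n ^ (n ^ 2)) \<longlonglongrightarrow> exp z"
  proof (rule power_tendsto_exp[OF norm])
    show "Re z \<le> 0" using p by (simp add: z_def v)
    show "(\<lambda>n. of_nat (n ^ 2) * (\<phi> n - 1)) \<longlonglongrightarrow> z"
      unfolding tendsto_complex_iff using Re Im by blast
    show "filterlim (\<lambda>n::nat. n ^ 2) at_top sequentially"
      by (rule filterlim_square_nat)
  qed
  also have "exp z = char (density lborel (normal_density (- v / 2) (sqrt v))) t"
  proof -
    have "v > 0" using p by (simp add: v)
    then have "char (density lborel (normal_density (- v / 2) (sqrt v))) t =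
        iexp (t * (- v / 2)) * complex_of_real (exp (- (v * t\<^sup>2 / 2)))"
      by (simp add: char_normal power_mult_distrib)
    also have "\<dots> = exp (\<i> * complex_of_real (- t * v / 2) + complex_of_real (- (v * t\<^sup>2 / 2)))"
      unfolding exp_add exp_of_real by simp
    finally show ?thesis by (simp add: z_def)
  qed
  finally show "(\<lambda>n. char (distr (bern_matrix p n) borel (log_edge_prod p n)) t) \<longlonglongrightarrow>
    char (density lborel (normal_density (- v / 2) (sqrt v))) t"
    by (simp add: char)
qed (use p in \<open>auto simp: v intro!: real_distribution_normal prob_space.real_distribution_distr[OF measure_pmf.prob_space_axioms]\<close>)

section \<open>Transfer from ln G to G and from G to H\<close>

lemma exp_log_edge_prod:
  assumes "n \<ge> 2"
  shows "exp (log_edge_prod p n xi) = edge_prod p n xi"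
proof -
  have "1 + ((if b then 1 / p else 0) - 1) / real n > 0" for b
  proof (cases b)
    case True
    have "1 / p \<ge> 1" using p by simp
    then show ?thesis using True by (simp add: add_pos_nonneg)
  next
    case False
    then show ?thesis using assms by (simp add: field_simps)
  qed
  then show ?thesis
    by (simp add: log_edge_prod_def edge_prod_def exp_sum)
qed

text \<open>The map x \<mapsto> \<open>iexp (t * x)\<close> is |t|-Lipschitz, so the difference is
  at most |t| E |H - G|, which the mean-square distance controls.\<close>

lemma char_H_minus_char_edge_prod_tendsto:
  "(\<lambda>n. char (distr (bern_matrix p n) borel (H_val p n)) t -
        measure_pmf.expectation (bern_matrix p n) (\<lambda>xi. iexp (t * edge_prod p n xi))) \<longlonglongrightarrow> 0"
proof (rule Lim_null_comparison)
  show "(\<lambda>n. \<bar>t\<bar> * sqrt (measure_pmf.expectation (bern_matrix p n) (\<lambda>xi. (H_val p n xi - edge_prod p n xi) ^ 2)))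
      \<longlonglongrightarrow> 0"
    using tendsto_mult_right_zero[OF tendsto_real_sqrt[OF expectation_H_minus_edge_prod_sq_tendsto, simplified]] .
  have "norm (char (distr (bern_matrix p n) borel (H_val p n)) t -
        measure_pmf.expectation (bern_matrix p n) (\<lambda>xi. iexp (t * edge_prod p n xi))) \<le>
      \<bar>t\<bar> * sqrt (measure_pmf.expectation (bern_matrix p n) (\<lambda>xi. (H_val p n xi - edge_prod p n xi) ^ 2))" for n
  proof -
    let ?D = "\<lambda>xi. \<bar>H_val p n xi - edge_prod p n xi\<bar>"
    have "norm (char (distr (bern_matrix p n) borel (H_val p n)) t -
        measure_pmf.expectation (bern_matrix p n) (\<lambda>xi. iexp (t * edge_prod p n xi))) =
      norm (measure_pmf.expectation (bern_matrix p n) (\<lambda>xi. iexp (t * H_val p n xi) - iexp (t * edge_prod p n xi)))"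
      by (simp add: char_def integral_distr integrable_bern_matrix)
    also have "\<dots> \<le> measure_pmf.expectation (bern_matrix p n) (\<lambda>xi. \<bar>t\<bar> * ?D xi)"
    proof (intro order_trans[OF integral_norm_bound] integral_mono integrable_bern_matrix)
      fix xi
      show "norm (iexp (t * H_val p n xi) - iexp (t * edge_prod p n xi)) \<le> \<bar>t\<bar> * ?D xi"
        using norm_iexp_diff_le[of "t * H_val p n xi" "t * edge_prod p n xi"]
        by (simp add: abs_mult flip: right_diff_distrib)
    qed
    also have "\<dots> = \<bar>t\<bar> * measure_pmf.expectation (bern_matrix p n) ?D"
      by simp
    also have "measure_pmf.expectation (bern_matrix p n) ?D \<le>
        sqrt (measure_pmf.expectation (bern_matrix p n) (\<lambda>xi. (H_val p n xi - edge_prod p n xi) ^ 2))"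
    proof (rule real_le_rsqrt)
      \<comment> \<open>Nonnegativity of the variance of |H - G| gives the needed case of
        Cauchy-Schwarz.\<close>
      have "0 \<le> measure_pmf.variance (bern_matrix p n) ?D"
        by (rule measure_pmf.variance_positive)
      also have "\<dots> = measure_pmf.expectation (bern_matrix p n) (\<lambda>xi. (?D xi)\<^sup>2) -
          (measure_pmf.expectation (bern_matrix p n) ?D)\<^sup>2"
        by (intro measure_pmf.variance_eq integrable_bern_matrix)
      finally show "(measure_pmf.expectation (bern_matrix p n) ?D)\<^sup>2 \<le>
          measure_pmf.expectation (bern_matrix p n) (\<lambda>xi. (H_val p n xi - edge_prod p n xi) ^ 2)"
        by simp
    qed
    finally show ?thesis by (simp add: mult_left_mono)
  qed
  then show "\<forall>\<^sub>F n in sequentially. norm (char (distr (bern_matrix p n) borel (H_val p n)) t -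
        measure_pmf.expectation (bern_matrix p n) (\<lambda>xi. iexp (t * edge_prod p n xi))) \<le>
      \<bar>t\<bar> * sqrt (measure_pmf.expectation (bern_matrix p n) (\<lambda>xi. (H_val p n xi - edge_prod p n xi) ^ 2))"
    by simp
qed

lemma weak_conv_H:
  "weak_conv_m (\<lambda>n. distr (bern_matrix p n) borel (H_val p n)) (lognormal (- v / 2) v)"
proof (rule levy_continuity)
  have v_pos: "v > 0" using p by (simp add: v)
  interpret N: real_distribution "density lborel (normal_density (- v / 2) (sqrt v))"
    using v_pos by (intro real_distribution_normal) simp
  show "real_distribution (lognormal (- v / 2) v)"
    unfolding lognormal_def by (intro N.real_distribution_distr) simp
  show "real_distribution (distr (bern_matrix p n) borel (H_val p n))" for n
    by (intro prob_space.real_distribution_distr[OF measure_pmf.prob_space_axioms]) simp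
  fix t :: real
  \<comment> \<open>The function x \<mapsto> \<open>iexp (t * exp x)\<close> is bounded and
    continuous, so testing the weak convergence of ln G on it yields the characteristic function of
    the lognormal law.\<close>
  have "(\<lambda>n. integral\<^sup>L (distr (bern_matrix p n) borel (log_edge_prod p n)) (\<lambda>x. iexp (t * exp x))) \<longlonglongrightarrow>
      integral\<^sup>L (density lborel (normal_density (- v / 2) (sqrt v))) (\<lambda>x. iexp (t * exp x))"
    by (rule weak_conv_imp_integral_bdd_continuous_conv[OF _ _ weak_conv_log_edge_prod, where B = 1])
       (simp_all add: prob_space.real_distribution_distr[OF measure_pmf.prob_space_axioms]
         N.real_distribution_axioms[simplified])
  also have "integral\<^sup>L (density lborel (normal_density (- v / 2) (sqrt v))) (\<lambda>x. iexp (t * exp x)) =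
      char (lognormal (- v / 2) v) t"
    by (simp add: char_def lognormal_def integral_distr)
  finally have "(\<lambda>n. measure_pmf.expectation (bern_matrix p n) (\<lambda>xi. iexp (t * edge_prod p n xi)))
      \<longlonglongrightarrow> char (lognormal (- v / 2) v) t"
    by (rule Lim_transform_eventually[OF _ eventually_mono[OF eventually_ge_at_top[of 2]]])
       (simp add: integral_distr flip: exp_log_edge_prod)
  from tendsto_add[OF char_H_minus_char_edge_prod_tendsto[of t] this]
  show "(\<lambda>n. char (distr (bern_matrix p n) borel (H_val p n)) t) \<longlonglongrightarrow> char (lognormal (- v / 2) v) t"
    by simp
qed

end

theorem theorem2:
  fixes p :: real
  assumes "0 < p" and "p < 1"
  shows "weak_conv_m (\<lambda>n. H_law p n) (lognormal (- (1 - p) / (2 * p)) ((1 - p) / p))"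
proof -
  have mean: "- (1 - p) / (2 * p) = - ((1 - p) / p) / 2"
    using assms by (simp add: field_simps)
  \<comment> \<open>\<open>H_law p n\<close> lives on the full power set sigma-algebra and not on
    the Borel sets, so the two measures differ as objects; \<open>weak_conv_m\<close> sees only
    their distribution functions, which agree.\<close>
  have "cdf (H_law p n) = cdf (distr (bern_matrix p n) borel (H_val p n))" for n
    by (simp add: fun_eq_iff cdf_def H_law_def measure_distr)
  then show ?thesis
    using weak_conv_H[OF assms refl] unfolding weak_conv_m_def mean by simp
qed

end
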